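(* Let $(G,\kappa)$ be a capacitated graph with $\kappa(u)\le d_G(u)$ for all $u\in V(G)$ and such that for every edge $uv$ of $G$ we have $\kappa(u)>0$ or $\kappa(v)>0$. Let $X=\{x\in V(G): \kappa(x)=d_G(x)\}$, $Y=N_G(X)\setminus X$ and $Z=V(G)\setminus (X\cup Y)$. If $X\cup Z$ is not an independent set in $G$, then $(G,\kappa)$ has at least two different $D$-sets. If $X\cup Z$ is an independent set in $G$, then the following three statements are equivalent: (a) $(G,\kappa)$ has a unique $D$-set; (b) for every set $\emptyset\neq W\subseteq Y^{\kappa>0}$ there is no matching from $L(W)$ to $W^{\kappa}$ of size $|L(W)|$ in the auxiliary graph $G^{\mathrm{aux}}$; (c) for every set $\emptyset\neq W\subseteq Y^{\kappa>0}$ we have $|L(W)|>|W^{\kappa}|$.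
   Context: All graphs are finite, undirected, without loops or parallel edges. A capacitated graph $(G,\kappa)$ is a graph $G$ together with a function $\kappa:V(G)\to\mathbb{Z}_{\ge 0}$; $\kappa(v)$ is the capacity of $v$. $d_G(v)$ is the degree of $v$ in $G$, $N_G(v)$ its neighbourhood (also written $N(v)$, $d(v)$), and $N_G(Q)=\bigcup_{x\in Q}N_G(x)$ for a vertex set $Q$. A $DP$-Nash subgraph (Nash subgraph) of $(G,\kappa)$ is a spanning subgraph $H$ of $G$ that is bipartite with partite sets $D$ and $P$ (called the $D$-set and $P$-set of $H$; one of them may be empty) such that no vertex of $P$ is isolated in $H$ and $d_H(x)=\min\{d_G(x),\kappa(x)\}$ for every $x\in D$. A set $B\subseteq V(G)$ is a $D$-set of $(G,\kappa)$ if $(G,\kappa)$ has a Nash subgraph whose $D$-set is $B$. For $U\subseteq V(G)$, $U^{\kappa}$ denotes the set of vertices obtained from $U$ by replacing each $u\in U$ by $\kappa(u)$ copies (so vertices of capacity $0$ disappear and $|U^{\kappa}|=\sum_{u\in U}\kappa(u)$). With $X,Y,Z$ as in the claim, the auxiliary graph $G^{\mathrm{aux}}$ of $(G,\kappa)$ is the bipartite graph with partite sets $R'=X\cup Z$ and $Y'=Y^{\kappa}$, where for $y\in Y$ a copy of $y$ is adjacent to $r\in R'$ in $G^{\mathrm{aux}}$ if and only if $yr\in E(G)$. $Y^{\kappa>0}=\{y\in Y:\kappa(y)>0\}$. For $\emptyset\ne W\subseteq Y^{\kappa>0}$, $L(W)=\{v\in X\cup Z : |N_G(v)\cap W|>d_G(v)-\kappa(v)\}$.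 A matching from $L(W)$ to $W^\kappa$ in $G^{\mathrm{aux}}$ is a matching each of whose edges joins a vertex of $L(W)$ to a vertex of $W^{\kappa}$. *)

theory Defs
  imports Main
begin

text \<open>
  A finite simple graph is given by a vertex set \<open>V\<close> and a set \<open>E\<close> of two-element subsets of \<open>V\<close>.
  A capacity function \<open>\<kappa>\<close> is total on the vertex type; only its values on \<open>V\<close> matter.
\<close>

definition fin_sgraph :: "'a set \<Rightarrow> 'a set set \<Rightarrow> bool" where
  "fin_sgraph V E \<longleftrightarrow> finite V \<and> (\<forall>e\<in>E. e \<subseteq> V \<and> card e = 2)"

definition nbhd :: "'a set set \<Rightarrow> 'a \<Rightarrow> 'a set" where
  "nbhd E v = {u. {v, u} \<in> E}"

definition nbhd_set :: "'a set set \<Rightarrow> 'a set \<Rightarrow> 'a set" where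
  "nbhd_set E Q = (\<Union>x\<in>Q. nbhd E x)"

definition deg :: "'a set set \<Rightarrow> 'a \<Rightarrow> nat" where
  "deg E v = card (nbhd E v)"

definition independent :: "'a set set \<Rightarrow> 'a set \<Rightarrow> bool" where
  "independent E S \<longleftrightarrow> (\<forall>u\<in>S. \<forall>v\<in>S. {u, v} \<notin> E)"

definition bipartite_with :: "'a set \<Rightarrow> 'a set set \<Rightarrow> 'a set \<Rightarrow> 'a set \<Rightarrow> bool" where
  "bipartite_with V F D P \<longleftrightarrow>
     D \<union> P = V \<and> D \<inter> P = {} \<and> (\<forall>e\<in>F. \<exists>d\<in>D. \<exists>p\<in>P. e = {d, p})"

text \<open>A spanning subgraph of \<open>(V, E)\<close> is determined by its edge set \<open>F \<subseteq> E\<close>.\<close>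

definition nash_subgraph ::
  "'a set \<Rightarrow> 'a set set \<Rightarrow> ('a \<Rightarrow> nat) \<Rightarrow> 'a set set \<Rightarrow> 'a set \<Rightarrow> 'a set \<Rightarrow> bool" where
  "nash_subgraph V E \<kappa> F D P \<longleftrightarrow>
     F \<subseteq> E \<and> bipartite_with V F D P \<and>
     (\<forall>p\<in>P. nbhd F p \<noteq> {}) \<and>
     (\<forall>x\<in>D. deg F x = min (deg E x) (\<kappa> x))"

definition is_D_set :: "'a set \<Rightarrow> 'a set set \<Rightarrow> ('a \<Rightarrow> nat) \<Rightarrow> 'a set \<Rightarrow> bool" where
  "is_D_set V E \<kappa> B \<longleftrightarrow> (\<exists>F P. nash_subgraph V E \<kappa> F B P)"

text \<open>The set \<open>U\<^sup>\<kappa>\<close>; the pair \<open>(u, i)\<close> is the \<open>i\<close>-th copy of \<open>u\<close>.\<close>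

definition copies :: "('a \<Rightarrow> nat) \<Rightarrow> 'a set \<Rightarrow> ('a \<times> nat) set" where
  "copies \<kappa> U = (SIGMA u:U. {..<\<kappa> u})"

definition pos_part :: "('a \<Rightarrow> nat) \<Rightarrow> 'a set \<Rightarrow> 'a set" where
  "pos_part \<kappa> Y = {y \<in> Y. \<kappa> y > 0}"

text \<open>
  Edge set of the auxiliary graph with partite sets \<open>Inl ` R\<close> and \<open>Inr ` copies \<kappa> Y\<close>; the sum type
  keeps the two sides disjoint.
\<close>

definition aux_edges ::
  "'a set set \<Rightarrow> ('a \<Rightarrow> nat) \<Rightarrow> 'a set \<Rightarrow> 'a set \<Rightarrow> ('a + 'a \<times> nat) set set" where
  "aux_edges E \<kappa> R Y =
     {{Inl r, Inr (y, i)} | r y i. r \<in> R \<and> (y, i) \<in> copies \<kappa> Y \<and> {y, r} \<in> E}"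

text \<open>
  The set \<open>L(W)\<close>, with \<open>R\<close> in the role of \<open>X \<union> Z\<close>. The difference is taken in the integers to
  avoid truncated subtraction.
\<close>

definition Lset :: "'a set set \<Rightarrow> ('a \<Rightarrow> nat) \<Rightarrow> 'a set \<Rightarrow> 'a set \<Rightarrow> 'a set" where
  "Lset E \<kappa> R W = {v \<in> R. int (card (nbhd E v \<inter> W)) > int (deg E v) - int (\<kappa> v)}"

definition matching :: "'b set set \<Rightarrow> 'b set set \<Rightarrow> bool" where
  "matching E M \<longleftrightarrow> M \<subseteq> E \<and> (\<forall>e\<in>M. \<forall>f\<in>M. e \<noteq> f \<longrightarrow> e \<inter> f = {})"

definition matching_from_to :: "'b set set \<Rightarrow> 'b set \<Rightarrow> 'b set \<Rightarrow> 'b set set \<Rightarrow> bool" where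
  "matching_from_to E S T M \<longleftrightarrow>
     matching E M \<and> (\<forall>e\<in>M. \<exists>s\<in>S. \<exists>t\<in>T. e = {s, t})"

end

theory Submission
  imports Defs
begin

text \<open>
  Everything rests on two ways of constructing D-sets. A D-set \<open>B\<close> is a set whose members \<open>x\<close> can each
  select \<open>min (deg E x) (\<kappa> x)\<close> neighbours outside \<open>B\<close> such that everything outside \<open>B\<close> is selected
  (\<open>is_D_set_iff_selection\<close>). If \<open>D0\<close> selects exactly \<open>P0\<close>
  and has no neighbours outside \<open>P0\<close>, then any D-set of the graph without \<open>D0 \<union> P0\<close> can be
  completed by \<open>D0\<close> (\<open>is_D_set_extend\<close>): a remaining vertex that lost neighbours lost them to \<open>P0\<close>
  only, and may select there. And deleting an edge whose two ends have more neighbours than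
  capacity (\<^emph>\<open>slack\<close> vertices) imposes nothing on the ends, so a D-set of the smaller graph is one of
  the larger (\<open>is_D_set_edge_deletion\<close>). A vertex whose capacity equals its degree (a \<^emph>\<open>tight\<close> vertex)
  can be put into a D-set together with its neighbours on the other side. Hence D-sets exist, and
  deleting edges at will lets us prescribe part of one.

  Write \<open>R = X \<union> Z\<close>. If \<open>R\<close> contains an edge \<open>uv\<close>, then either both ends are in \<open>X\<close>, hence
  tight, or both are in \<open>Z\<close>, hence have only slack neighbours and can be made tight by deleting
  edges. If \<open>\<kappa> u > 0\<close>, this can be done for \<open>u\<close> without deleting \<open>uv\<close>, which gives a D-set
  containing \<open>u\<close> but not \<open>v\<close>; making \<open>v\<close> tight instead gives one containing \<open>v\<close>.

  If \<open>R\<close> is independent, then \<open>R\<close> itself is a D-set, since \<open>X\<close> covers \<open>Y\<close>, so uniqueness means that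
  no other D-set exists. For another D-set \<open>B\<close>, put \<open>W\<close> for the vertices of positive capacity in
  \<open>B \<inter> Y\<close>; the vertices of \<open>L(W)\<close> have too few neighbours outside \<open>W\<close> to lie in \<open>B\<close>, so they are
  selected by \<open>W\<close>, and this is a matching of \<open>L(W)\<close> into \<open>W\<^sup>\<kappa>\<close>
  (\<open>other_D_set_imp_assignment\<close>). Conversely, given a matching of \<open>L(W)\<close>, delete the edges from
  \<open>W\<close> to vertices outside \<open>L(W)\<close> one by one. Either some vertex of \<open>Y\<close> becomes tight on the way and
  can be put into a D-set, or in the end \<open>W\<close> is adjacent to \<open>L(W)\<close> only, and the matching allows
  \<open>W\<close> to be put into a D-set with \<open>L(W)\<close> on the other side (\<open>exists_D_set_meeting\<close>). Either way a
  D-set meets \<open>Y\<close>.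

  Finally, (c) clearly implies (b). For the converse, if \<open>|L(W)| \<le> |W\<^sup>\<kappa>|\<close> but \<open>L(W)\<close> has no
  matching, then removing from \<open>W\<close> the neighbours of a set violating Hall's condition gives a smaller
  such \<open>W\<close>, so a minimal one has a matching (\<open>small_Lset_imp_injection\<close>).
\<close>

section \<open>Graphs\<close>

lemma nbhd_sym: "u \<in> nbhd E v \<longleftrightarrow> v \<in> nbhd E u"
  by (simp add: nbhd_def insert_commute)

lemma not_self_nbhd: "fin_sgraph V E \<Longrightarrow> v \<notin> nbhd E v"
  by (auto simp: fin_sgraph_def nbhd_def)

lemma nbhd_subset: "fin_sgraph V E \<Longrightarrow> nbhd E v \<subseteq> V"
  by (auto simp: fin_sgraph_def nbhd_def)

lemma finite_nbhd: "fin_sgraph V E \<Longrightarrow> finite (nbhd E v)"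
  using nbhd_subset finite_subset by (metis fin_sgraph_def)

lemma finite_edges: "fin_sgraph V E \<Longrightarrow> finite E"
  by (meson Pow_iff fin_sgraph_def finite_Pow_iff finite_subset subsetI)

lemma fin_sgraph_subgraph: "fin_sgraph V E \<Longrightarrow> F \<subseteq> E \<Longrightarrow> fin_sgraph V F"
  by (auto simp: fin_sgraph_def)

lemma fin_sgraph_induced: "fin_sgraph V E \<Longrightarrow> U \<subseteq> V \<Longrightarrow> fin_sgraph U {e \<in> E. e \<subseteq> U}"
  by (auto simp: fin_sgraph_def intro: finite_subset)

lemma nbhd_induced: "v \<in> U \<Longrightarrow> nbhd {e \<in> E. e \<subseteq> U} v = nbhd E v \<inter> U"
  by (auto simp: nbhd_def)

lemma nbhd_delete_edge:
  "nbhd (E - {{u, v}}) x =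
     (if x = u then nbhd E x - {v} else if x = v then nbhd E x - {u} else nbhd E x)"
  by (auto simp: nbhd_def doubleton_eq_iff)

section \<open>Constructing D-sets\<close>

text \<open>
  \<open>A x\<close> is the neighbourhood of \<open>x\<close> in a Nash subgraph with D-set \<open>B\<close>: families of sets are easier
  to combine and to enlarge than edge sets.
\<close>

definition selection ::
  "'a set \<Rightarrow> 'a set set \<Rightarrow> ('a \<Rightarrow> nat) \<Rightarrow> 'a set \<Rightarrow> ('a \<Rightarrow> 'a set) \<Rightarrow> bool" where
  "selection V E \<kappa> B A \<longleftrightarrow>
     B \<subseteq> V \<and> (\<forall>x\<in>B. A x \<subseteq> nbhd E x - B \<and> card (A x) = min (deg E x) (\<kappa> x)) \<and>
     V - B \<subseteq> (\<Union>x\<in>B. A x)"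

lemma is_D_set_iff_selection:
  assumes g: "fin_sgraph V E"
  shows "is_D_set V E \<kappa> B \<longleftrightarrow> (\<exists>A. selection V E \<kappa> B A)"
proof
  assume "is_D_set V E \<kappa> B"
  then obtain F P where n: "nash_subgraph V E \<kappa> F B P" by (auto simp: is_D_set_def)
  then have FE: "F \<subseteq> E" and part: "B \<union> P = V" "B \<inter> P = {}"
    and bip: "\<And>e. e \<in> F \<Longrightarrow> \<exists>d\<in>B. \<exists>p\<in>P. e = {d, p}"
    and ne: "\<And>p. p \<in> P \<Longrightarrow> nbhd F p \<noteq> {}"
    and dg: "\<And>x. x \<in> B \<Longrightarrow> deg F x = min (deg E x) (\<kappa> x)"
    by (auto simp: nash_subgraph_def bipartite_with_def)
  have BP: "v \<in> P" if "u \<in> B" "{u, v} \<in> F" for u v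
    using bip[OF that(2)] that(1) part(2) by (auto simp: doubleton_eq_iff)
  have PB: "v \<in> B" if "u \<in> P" "{u, v} \<in> F" for u v
    using bip[OF that(2)] that(1) part(2) by (auto simp: doubleton_eq_iff)
  have "selection V E \<kappa> B (nbhd F)"
    unfolding selection_def
  proof (intro conjI ballI subsetI)
    show "x \<in> V" if "x \<in> B" for x using part that by auto
    show "y \<in> nbhd E x - B" if "x \<in> B" "y \<in> nbhd F x" for x y
      using that BP[of x y] part(2) FE by (auto simp: nbhd_def)
    show "card (nbhd F x) = min (deg E x) (\<kappa> x)" if "x \<in> B" for x
      using dg[OF that] by (simp add: deg_def)
    show "p \<in> (\<Union>x\<in>B. nbhd F x)" if p: "p \<in> V - B" for p
    proof -
      have pP: "p \<in> P" using p part by auto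
      then obtain x where "x \<in> nbhd F p" using ne by blast
      moreover from this have "x \<in> B" using PB pP by (auto simp: nbhd_def)
      ultimately show ?thesis using nbhd_sym by fast
    qed
  qed
  then show "\<exists>A. selection V E \<kappa> B A" by blast
next
  assume "\<exists>A. selection V E \<kappa> B A"
  then obtain A where BV: "B \<subseteq> V" and A: "\<And>x. x \<in> B \<Longrightarrow> A x \<subseteq> nbhd E x - B"
    and c: "\<And>x. x \<in> B \<Longrightarrow> card (A x) = min (deg E x) (\<kappa> x)"
    and cov: "V - B \<subseteq> (\<Union>x\<in>B. A x)"
    by (auto simp: selection_def)
  define F where "F = {{x, p} | x p. x \<in> B \<and> p \<in> A x}"
  have nF: "nbhd F x = A x" if "x \<in> B" for x
    using that A by (auto simp: nbhd_def F_def doubleton_eq_iff)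
  have "nash_subgraph V E \<kappa> F B (V - B)"
    unfolding nash_subgraph_def bipartite_with_def
  proof (intro conjI ballI)
    show "F \<subseteq> E" using A by (fastforce simp: F_def nbhd_def)
    show "\<exists>d\<in>B. \<exists>p\<in>V - B. e = {d, p}" if "e \<in> F" for e
      using that A nbhd_subset[OF g] by (fastforce simp: F_def)
    show "nbhd F p \<noteq> {}" if p: "p \<in> V - B" for p
    proof -
      obtain x where "x \<in> B" "p \<in> A x" using p cov by auto
      then have "p \<in> nbhd F x" using nF by simp
      then show ?thesis using nbhd_sym by fast
    qed
    show "deg F x = min (deg E x) (\<kappa> x)" if "x \<in> B" for x
      using nF[OF that] c[OF that] by (simp add: deg_def)
  qed (use BV in auto)
  then show "is_D_set V E \<kappa> B" by (auto simp: is_D_set_def)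
qed

text \<open>
  A Nash subgraph of \<open>F\<close> is one of \<open>E\<close> as soon as no vertex has to select more in \<open>E\<close>; this is so
  when only edges between slack vertices are deleted, and none of them falls below its capacity.
\<close>

lemma is_D_set_edge_deletion:
  assumes "F \<subseteq> E" and eq: "\<And>v. v \<in> V \<Longrightarrow> min (deg F v) (\<kappa> v) = min (deg E v) (\<kappa> v)"
    and "is_D_set V F \<kappa> B"
  shows "is_D_set V E \<kappa> B"
proof -
  obtain H P where n: "nash_subgraph V F \<kappa> H B P" using assms(3) by (auto simp: is_D_set_def)
  then have "B \<subseteq> V" by (auto simp: nash_subgraph_def bipartite_with_def)
  then have "nash_subgraph V E \<kappa> H B P"
    using n assms(1) eq by (auto simp: nash_subgraph_def subset_iff)
  then show ?thesis by (auto simp: is_D_set_def)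
qed

text \<open>
  No edge joins \<open>D0\<close> to the rest of the graph, so a remaining vertex \<open>x\<close> is deprived of
  neighbours in \<open>P0\<close> only. If \<open>x \<in> B\<close> selects fewer than \<open>\<kappa> x\<close> vertices in the rest, it selects all its neighbours
  there, so none of them is in \<open>B\<close>, and it can enlarge its selection within its whole neighbourhood.
\<close>

lemma is_D_set_extend:
  assumes g: "fin_sgraph V E"
    and sub: "D0 \<subseteq> V" "P0 \<subseteq> V" "D0 \<inter> P0 = {}"
    and closed: "\<And>x. x \<in> D0 \<Longrightarrow> nbhd E x \<subseteq> P0"
    and sel: "\<And>x. x \<in> D0 \<Longrightarrow> A0 x \<subseteq> nbhd E x \<and> card (A0 x) = min (deg E x) (\<kappa> x)"
    and cov: "P0 \<subseteq> (\<Union>x\<in>D0. A0 x)"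
    and rest: "is_D_set (V - D0 - P0) {e \<in> E. e \<subseteq> V - D0 - P0} \<kappa> B"
  shows "is_D_set V E \<kappa> (D0 \<union> B)"
proof -
  define U where "U = V - D0 - P0"
  define E' where "E' = {e \<in> E. e \<subseteq> U}"
  have g': "fin_sgraph U E'"
    using fin_sgraph_induced[OF g, of U] by (auto simp: U_def E'_def)
  obtain A' where "selection U E' \<kappa> B A'"
    using rest is_D_set_iff_selection[OF g'] by (auto simp: U_def E'_def)
  then have BU: "B \<subseteq> U" and A': "\<And>x. x \<in> B \<Longrightarrow> A' x \<subseteq> nbhd E' x - B"
    and c': "\<And>x. x \<in> B \<Longrightarrow> card (A' x) = min (deg E' x) (\<kappa> x)"
    and cov': "U - B \<subseteq> (\<Union>x\<in>B. A' x)"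
    by (auto simp: selection_def)
  have "\<exists>S. A' x \<subseteq> S \<and> S \<subseteq> nbhd E x - (D0 \<union> B) \<and> card S = min (deg E x) (\<kappa> x)"
    if x: "x \<in> B" for x
  proof -
    have xU: "x \<in> U" using x BU by auto
    have n': "nbhd E' x = nbhd E x \<inter> U" using xU by (simp add: E'_def nbhd_induced)
    have noD: "nbhd E x \<inter> D0 = {}"
    proof (rule ccontr)
      assume "nbhd E x \<inter> D0 \<noteq> {}"
      then obtain y where "y \<in> D0" "y \<in> nbhd E x" by auto
      then have "x \<in> P0" using closed nbhd_sym by fast
      then show False using xU by (simp add: U_def)
    qed
    have fin: "finite (nbhd E x)" "finite (nbhd E' x)" using finite_nbhd[OF g] finite_nbhd[OF g'] by auto
    have le: "deg E' x \<le> deg E x" using n' fin by (simp add: deg_def card_mono)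
    show ?thesis
    proof (cases "\<kappa> x \<le> deg E' x")
      case True
      then show ?thesis using A'[OF x] c'[OF x] n' noD le by (intro exI[of _ "A' x"]) auto
    next
      case False
      then have "card (A' x) = card (nbhd E' x)" using c'[OF x] by (simp add: deg_def)
      then have all: "A' x = nbhd E' x" using A'[OF x] fin by (meson Diff_subset card_subset_eq subset_trans)
      then have "nbhd E x \<inter> B = {}" using A'[OF x] n' BU by auto
      then have avail: "nbhd E x - (D0 \<union> B) = nbhd E x" using noD by auto
      have "A' x \<subseteq> nbhd E x" using all n' by auto
      moreover have "card (A' x) \<le> min (deg E x) (\<kappa> x)" using c'[OF x] le by simp
      ultimately show ?thesis unfolding avail
        using exists_subset_between[of "A' x" "min (deg E x) (\<kappa> x)" "nbhd E x"] fin
        by (auto simp: deg_def)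
    qed
  qed
  then obtain S where S: "\<And>x. x \<in> B \<Longrightarrow>
      A' x \<subseteq> S x \<and> S x \<subseteq> nbhd E x - (D0 \<union> B) \<and> card (S x) = min (deg E x) (\<kappa> x)"
    by metis
  have "selection V E \<kappa> (D0 \<union> B) (\<lambda>x. if x \<in> D0 then A0 x else S x)"
    unfolding selection_def
  proof (intro conjI ballI)
    show "D0 \<union> B \<subseteq> V" using sub BU by (auto simp: U_def)
    fix x assume x: "x \<in> D0 \<union> B"
    show "(if x \<in> D0 then A0 x else S x) \<subseteq> nbhd E x - (D0 \<union> B)"
    proof (cases "x \<in> D0")
      case True
      then have "A0 x \<subseteq> P0" "A0 x \<subseteq> nbhd E x" using sel closed by blast+
      then show ?thesis using True sub BU by (auto simp: U_def)
    qed (use x S in auto)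
    show "card (if x \<in> D0 then A0 x else S x) = min (deg E x) (\<kappa> x)"
      using x S sel by auto
  next
    show "V - (D0 \<union> B) \<subseteq> (\<Union>x\<in>D0 \<union> B. if x \<in> D0 then A0 x else S x)"
    proof
      fix v assume v: "v \<in> V - (D0 \<union> B)"
      show "v \<in> (\<Union>x\<in>D0 \<union> B. if x \<in> D0 then A0 x else S x)"
      proof (cases "v \<in> P0")
        case True
        then obtain x where "x \<in> D0" "v \<in> A0 x" using cov by auto
        then show ?thesis by auto
      next
        case False
        then have "v \<in> U - B" using v by (auto simp: U_def)
        then obtain x where x: "x \<in> B" "v \<in> A' x" using cov' by auto
        then have "x \<notin> D0" "v \<in> S x" using BU S by (auto simp: U_def)
        then show ?thesis using x by auto
      qed
    qed
  qed
  then show ?thesis using is_D_set_iff_selection[OF g] by blast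
qed

lemma deg_delete_edge:
  assumes "fin_sgraph V E" "{u, v} \<in> E"
  shows "deg (E - {{u, v}}) x = (if x = u \<or> x = v then deg E x - 1 else deg E x)"
proof -
  have "v \<in> nbhd E u" "u \<in> nbhd E v" using assms(2) by (auto simp: nbhd_def insert_commute)
  then show ?thesis
    using finite_nbhd[OF assms(1)] by (auto simp: deg_def nbhd_delete_edge)
qed

text \<open>
  A vertex with capacity at least its degree takes all its neighbours, and the rest is smaller. If there
  is no such vertex, all vertices are slack and any edge can be deleted.
\<close>

theorem D_set_exists:
  assumes "fin_sgraph V E"
  shows "\<exists>B. is_D_set V E \<kappa> B"
  using assms
proof (induction "card V + card E" arbitrary: V E rule: less_induct)
  case less
  note g = less.prems
  have fin: "finite V" "finite E" using g finite_edges by (auto simp: fin_sgraph_def)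
  show ?case
  proof (cases "\<exists>x\<in>V. deg E x \<le> \<kappa> x")
    case True
    then obtain x where x: "x \<in> V" "deg E x \<le> \<kappa> x" by auto
    define U where "U = V - {x} - nbhd E x"
    have "card U < card V" using x fin by (intro psubset_card_mono) (auto simp: U_def)
    moreover have "card {e \<in> E. e \<subseteq> U} \<le> card E" using fin by (intro card_mono) auto
    moreover have "fin_sgraph U {e \<in> E. e \<subseteq> U}"
      using g by (intro fin_sgraph_induced) (auto simp: U_def)
    ultimately obtain B where B: "is_D_set U {e \<in> E. e \<subseteq> U} \<kappa> B"
      using less.hyps[of U "{e \<in> E. e \<subseteq> U}"] by auto
    have "is_D_set V E \<kappa> ({x} \<union> B)"
      by (rule is_D_set_extend[where ?P0.0 = "nbhd E x" and ?A0.0 = "nbhd E", OF g])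
        (use B x not_self_nbhd[OF g] nbhd_subset[OF g] in \<open>auto simp: U_def deg_def\<close>)
    then show ?thesis by blast
  next
    case False
    show ?thesis
    proof (cases "V = {}")
      case True
      then have "selection V E \<kappa> {} (\<lambda>_. {})" by (simp add: selection_def)
      then show ?thesis using is_D_set_iff_selection[OF g] by blast
    next
      case nonempty: False
      then obtain u where u: "u \<in> V" by auto
      then have "\<kappa> u < deg E u" using False by auto
      then have "nbhd E u \<noteq> {}" by (auto simp: deg_def)
      then obtain v where e: "{u, v} \<in> E" by (auto simp: nbhd_def)
      define F where "F = E - {{u, v}}"
      have "card F < card E" using e fin unfolding F_def by (intro card_Diff1_less)
      moreover have "fin_sgraph V F" using g by (auto simp: F_def fin_sgraph_def)
      ultimately obtain B where B: "is_D_set V F \<kappa> B" using less.hyps[of V F] by auto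
      have "min (deg F x) (\<kappa> x) = min (deg E x) (\<kappa> x)" if "x \<in> V" for x
        using False that deg_delete_edge[OF g e, of x] by (fastforce simp: F_def)
      then have "is_D_set V E \<kappa> B"
        using B by (rule is_D_set_edge_deletion[rotated]) (auto simp: F_def)
      then show ?thesis by blast
    qed
  qed
qed

lemma D_set_extending:
  assumes g: "fin_sgraph V E"
    and "D0 \<subseteq> V" "P0 \<subseteq> V" "D0 \<inter> P0 = {}"
    and "\<And>x. x \<in> D0 \<Longrightarrow> nbhd E x \<subseteq> P0"
    and "\<And>x. x \<in> D0 \<Longrightarrow> A0 x \<subseteq> nbhd E x \<and> card (A0 x) = min (deg E x) (\<kappa> x)"
    and "P0 \<subseteq> (\<Union>x\<in>D0. A0 x)"
  obtains B where "is_D_set V E \<kappa> B" "D0 \<subseteq> B" "P0 \<inter> B = {}"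
proof -
  define U where "U = V - D0 - P0"
  have gU: "fin_sgraph U {e \<in> E. e \<subseteq> U}"
    using g by (intro fin_sgraph_induced) (auto simp: U_def)
  then obtain B where B: "is_D_set U {e \<in> E. e \<subseteq> U} \<kappa> B" using D_set_exists by blast
  then have "B \<subseteq> U" using is_D_set_iff_selection[OF gU] by (auto simp: selection_def)
  then have "P0 \<inter> (D0 \<union> B) = {}" using assms by (auto simp: U_def)
  moreover have "is_D_set V E \<kappa> (D0 \<union> B)"
    using assms B unfolding U_def by (rule is_D_set_extend[where ?P0.0 = P0 and ?A0.0 = A0]) auto
  ultimately show ?thesis using that by blast
qed

text \<open>
  Deleting the edges from \<open>u\<close> to its neighbours outside \<open>A\<close> makes \<open>u\<close> tight. Each of these neighbours
  loses just one edge, so slack suffices for the deletions to be harmless.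
\<close>

lemma D_set_containing_vertex:
  assumes g: "fin_sgraph V E" and u: "u \<in> V" and A: "A \<subseteq> nbhd E u" "card A = \<kappa> u"
    and slack: "\<And>v. v \<in> nbhd E u - A \<Longrightarrow> \<kappa> v < deg E v"
  obtains B where "is_D_set V E \<kappa> B" "u \<in> B" "A \<inter> B = {}"
proof -
  define F where "F = E - {{u, v} | v. v \<in> nbhd E u - A}"
  have FE: "F \<subseteq> E" by (auto simp: F_def)
  have gF: "fin_sgraph V F" using g FE by (rule fin_sgraph_subgraph)
  have irr: "u \<notin> nbhd E u" using not_self_nbhd[OF g] .
  have nu: "nbhd F u = A" using A(1) irr by (auto simp: F_def nbhd_def doubleton_eq_iff)
  have nv: "nbhd F v = (if v \<in> nbhd E u - A then nbhd E v - {u} else nbhd E v)" if "v \<noteq> u" for v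
    using that irr by (auto simp: F_def nbhd_def doubleton_eq_iff insert_commute)
  have eq: "min (deg F v) (\<kappa> v) = min (deg E v) (\<kappa> v)" for v
  proof (cases "v = u")
    case True
    have "card A \<le> deg E u" using A(1) finite_nbhd[OF g] by (simp add: deg_def card_mono)
    then show ?thesis using True nu A(2) by (simp add: deg_def)
  next
    case False
    show ?thesis
    proof (cases "v \<in> nbhd E u - A")
      case True
      then have "u \<in> nbhd E v" using nbhd_sym by fast
      then have "deg F v = deg E v - 1"
        using nv[OF False] True finite_nbhd[OF g] by (simp add: deg_def)
      then show ?thesis using slack[OF True] by simp
    qed (use nv[OF False] in \<open>auto simp: deg_def\<close>)
  qed
  obtain B where B: "is_D_set V F \<kappa> B" "{u} \<subseteq> B" "A \<inter> B = {}"
  proof (rule D_set_extending[OF gF, where ?D0.0 = "{u}" and ?P0.0 = A and ?A0.0 = "\<lambda>_. A" and \<kappa> = \<kappa>])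
    show "A \<subseteq> V" using A(1) nbhd_subset[OF g] by blast
    show "{u} \<inter> A = {}" using A(1) irr by auto
    show "A \<subseteq> nbhd F x \<and> card A = min (deg F x) (\<kappa> x)" if "x \<in> {u}" for x
      using that nu A(2) by (simp add: deg_def)
  qed (use u nu in auto)
  then show ?thesis using that is_D_set_edge_deletion[OF FE eq] by blast
qed

text \<open>
  The way from a matching to a second D-set: \<open>g\<close> assigns to each vertex of \<open>L\<close> its partner in \<open>W\<close>. For
  the induction over edge deletions \<open>L\<close> is a fixed set instead of the set \<open>L(W)\<close> of the current graph,
  and the vertices outside \<open>Y \<union> L\<close> are only required to have enough neighbours outside \<open>W\<close>. Edges at \<open>W\<close>
  do not count there, so this is preserved and also makes such a vertex slack whenever it has a
  neighbour in \<open>W\<close>. A tight vertex of \<open>Y\<close>, which could block a deletion, already gives a D-set.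
\<close>

lemma exists_D_set_meeting:
  assumes "fin_sgraph V E" and "\<And>v. v \<in> V \<Longrightarrow> \<kappa> v \<le> deg E v"
    and "W \<noteq> {}" "W \<subseteq> Y" "Y \<subseteq> V" "L \<subseteq> V - Y"
    and "\<And>v. v \<in> V - Y - L \<Longrightarrow> \<kappa> v \<le> card (nbhd E v - W)"
    and "\<And>l. l \<in> L \<Longrightarrow> g l \<in> W \<and> {g l, l} \<in> E"
    and "\<And>w. w \<in> W \<Longrightarrow> card {l \<in> L. g l = w} \<le> \<kappa> w"
  shows "\<exists>B. is_D_set V E \<kappa> B \<and> B \<inter> Y \<noteq> {}"
  using assms(1,2,7,8)
proof (induction "card E" arbitrary: E rule: less_induct)
  case less
  note g = less.prems(1) and cap = less.prems(2) and free = less.prems(3) and mat = less.prems(4)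
  note fn = finite_nbhd[OF g]
  consider (tight) y where "y \<in> Y" "deg E y = \<kappa> y"
    | (delete) w v where "\<And>y. y \<in> Y \<Longrightarrow> \<kappa> y < deg E y" "w \<in> W" "{w, v} \<in> E" "v \<notin> L"
    | (closed) "\<And>w. w \<in> W \<Longrightarrow> nbhd E w \<subseteq> L"
  proof (cases "\<exists>y\<in>Y. deg E y = \<kappa> y")
    case False
    then have "\<And>y. y \<in> Y \<Longrightarrow> \<kappa> y < deg E y" using cap assms(5) by (metis le_neq_implies_less subsetD)
    then show ?thesis using that(2,3) by (fastforce simp: nbhd_def)
  qed (use that in blast)
  then show ?case
  proof cases
    case tight
    have "y \<in> V" using tight assms(5) by auto
    then obtain B where "is_D_set V E \<kappa> B" "y \<in> B"
      using D_set_containing_vertex[OF g, of y "nbhd E y" \<kappa>] tight(2) by (auto simp: deg_def)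
    then show ?thesis using tight(1) by blast
  next
    case delete
    have wV: "w \<in> Y" "w \<in> V" and vV: "v \<in> V" and wv: "w \<in> nbhd E v" "w \<noteq> v"
      using delete(2,3) assms(4,5) g by (auto simp: fin_sgraph_def nbhd_def insert_commute)
    have slack: "\<kappa> v < deg E v"
    proof (cases "v \<in> Y")
      case False
      then have "\<kappa> v \<le> card (nbhd E v - W)" using free vV delete(4) by auto
      also have "\<dots> < card (nbhd E v)" using wv delete(2) fn by (intro psubset_card_mono) auto
      finally show ?thesis by (simp add: deg_def)
    qed (use delete(1) in auto)
    define F where "F = E - {{w, v}}"
    have FE: "F \<subseteq> E" by (auto simp: F_def)
    have dF: "deg F x = (if x = w \<or> x = v then deg E x - 1 else deg E x)" for x
      using deg_delete_edge[OF g delete(3)] by (simp add: F_def)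
    have capF: "\<kappa> x \<le> deg F x" if "x \<in> V" for x
      using cap[OF that] slack delete(1)[OF wV(1)] by (auto simp: dF)
    have "\<exists>B. is_D_set V F \<kappa> B \<and> B \<inter> Y \<noteq> {}"
    proof (rule less.hyps)
      show "card F < card E"
        using delete(3) finite_edges[OF g] unfolding F_def by (intro card_Diff1_less)
      show "fin_sgraph V F" using g FE by (rule fin_sgraph_subgraph)
      show "\<kappa> x \<le> card (nbhd F x - W)" if x: "x \<in> V - Y - L" for x
      proof -
        have "nbhd F x - W = nbhd E x - W"
          using x delete(2) wV(1) by (auto simp: F_def nbhd_delete_edge)
        then show ?thesis using free[OF x] by simp
      qed
      show "g l \<in> W \<and> {g l, l} \<in> F" if l: "l \<in> L" for l
        using mat[OF l] l delete(4) assms(6) wV(1) by (auto simp: F_def doubleton_eq_iff)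
    qed (rule capF)
    then obtain B where B: "is_D_set V F \<kappa> B" "B \<inter> Y \<noteq> {}" by blast
    have "is_D_set V E \<kappa> B"
      using FE _ B(1) by (rule is_D_set_edge_deletion) (simp add: cap capF min_absorb2)
    then show ?thesis using B(2) by blast
  next
    case closed
    have "\<exists>S. {l \<in> L. g l = w} \<subseteq> S \<and> S \<subseteq> nbhd E w \<and> card S = min (deg E w) (\<kappa> w)"
      if w: "w \<in> W" for w
    proof -
      have "{l \<in> L. g l = w} \<subseteq> nbhd E w" using mat by (auto simp: nbhd_def)
      moreover have "w \<in> V" using w assms(4,5) by auto
      ultimately show ?thesis
        using exists_subset_between[of "{l \<in> L. g l = w}" "\<kappa> w" "nbhd E w"]
          assms(9)[OF w] cap[of w] fn by (auto simp: deg_def min_absorb2)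
    qed
    then obtain S where S: "\<And>w. w \<in> W \<Longrightarrow>
        {l \<in> L. g l = w} \<subseteq> S w \<and> S w \<subseteq> nbhd E w \<and> card (S w) = min (deg E w) (\<kappa> w)"
      by metis
    obtain B where "is_D_set V E \<kappa> B" "W \<subseteq> B"
    proof (rule D_set_extending[OF g, where ?D0.0 = W and ?P0.0 = L and ?A0.0 = S and \<kappa> = \<kappa>])
      show "L \<subseteq> (\<Union>x\<in>W. S x)" using S mat by blast
    qed (use assms(4-6) closed S in auto)
    then show ?thesis using assms(3,4) by blast
  qed
qed

section \<open>Hall's theorem\<close>

text \<open>
  The argument of Halmos and Vaughan: if a proper nonempty subfamily \<open>J\<close> has no surplus, the rest
  satisfies Hall's condition outside the union of \<open>J\<close>; if every such subfamily has surplus, any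
  representative of any one set can be fixed.
\<close>

theorem hall:
  assumes "finite I" and "\<And>i. i \<in> I \<Longrightarrow> finite (A i)"
    and "\<And>J. J \<subseteq> I \<Longrightarrow> card J \<le> card (\<Union>j\<in>J. A j)"
  shows "\<exists>f. inj_on f I \<and> (\<forall>i\<in>I. f i \<in> A i)"
  using assms
proof (induction "card I" arbitrary: I A rule: less_induct)
  case less
  note finI = less.prems(1) and finA = less.prems(2) and hall = less.prems(3)
  show ?case
  proof (cases "\<exists>J. J \<noteq> {} \<and> J \<subset> I \<and> card (\<Union>j\<in>J. A j) = card J")
    case True
    then obtain J where J: "J \<noteq> {}" "J \<subset> I" "card (\<Union>j\<in>J. A j) = card J" by auto
    define U where "U = (\<Union>j\<in>J. A j)"
    have finJ: "finite J" using J(2) finI finite_subset by auto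
    have finU: "finite U" using finJ finA J(2) by (auto simp: U_def)
    have "card J < card I" using J(2) finI by (rule psubset_card_mono[rotated])
    then have "\<exists>f. inj_on f J \<and> (\<forall>i\<in>J. f i \<in> A i)"
    proof (rule less.hyps)
      show "card K \<le> card (\<Union>k\<in>K. A k)" if "K \<subseteq> J" for K
        using that J(2) by (intro hall) auto
    qed (use finJ finA J(2) in auto)
    then obtain f where f: "inj_on f J" "\<And>i. i \<in> J \<Longrightarrow> f i \<in> A i" by auto
    have "\<exists>h. inj_on h (I - J) \<and> (\<forall>i\<in>I - J. h i \<in> A i - U)"
    proof (rule less.hyps)
      show "card (I - J) < card I" using J(1,2) finI by (intro psubset_card_mono) auto
      show "card K \<le> card (\<Union>k\<in>K. A k - U)" if K: "K \<subseteq> I - J" for K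
      proof -
        have finK: "finite K" using K finI finite_subset by auto
        have "card K + card J = card (K \<union> J)" using K finK finJ by (subst card_Un_disjoint) auto
        also have "\<dots> \<le> card (\<Union>k\<in>K \<union> J. A k)" using K J(2) by (intro hall) auto
        also have "(\<Union>k\<in>K \<union> J. A k) = (\<Union>k\<in>K. A k - U) \<union> U" by (auto simp: U_def)
        also have "card \<dots> \<le> card (\<Union>k\<in>K. A k - U) + card U" by (rule card_Un_le)
        finally show ?thesis using J(3) by (simp add: U_def)
      qed
    qed (use finI finA in auto)
    then obtain h where h: "inj_on h (I - J)" "\<And>i. i \<in> I - J \<Longrightarrow> h i \<in> A i - U" by auto
    have "inj_on (\<lambda>i. if i \<in> J then f i else h i) I"
    proof (rule inj_onI)
      fix a b assume ab: "a \<in> I" "b \<in> I"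
        "(if a \<in> J then f a else h a) = (if b \<in> J then f b else h b)"
      have "f i \<in> U" if "i \<in> J" for i using f(2)[OF that] that by (auto simp: U_def)
      then show "a = b" using ab h f(1) inj_onD[OF h(1), of a b] inj_onD[OF f(1), of a b]
        by (cases "a \<in> J"; cases "b \<in> J") (auto, (metis DiffE DiffI)+)
    qed
    moreover have "\<forall>i\<in>I. (if i \<in> J then f i else h i) \<in> A i" using f h by auto
    ultimately show ?thesis by blast
  next
    case False
    show ?thesis
    proof (cases "I = {}")
      case nonempty: False
      then obtain i where i: "i \<in> I" by auto
      have "A i \<noteq> {}" using hall[of "{i}"] i by auto
      then obtain a where a: "a \<in> A i" by auto
      have "\<exists>h. inj_on h (I - {i}) \<and> (\<forall>k\<in>I - {i}. h k \<in> A k - {a})"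
      proof (rule less.hyps)
        show "card (I - {i}) < card I" using i finI by (intro psubset_card_mono) auto
        show "card K \<le> card (\<Union>k\<in>K. A k - {a})" if K: "K \<subseteq> I - {i}" for K
        proof (cases "K = {}")
          case K0: False
          have KI: "K \<subset> I" using K i by auto
          then have "card (\<Union>k\<in>K. A k) \<noteq> card K" using False K0 by blast
          then have "card K < card (\<Union>k\<in>K. A k)" using hall[OF psubset_imp_subset[OF KI]] by simp
          moreover have "(\<Union>k\<in>K. A k - {a}) = (\<Union>k\<in>K. A k) - {a}" by auto
          moreover have "card (\<Union>k\<in>K. A k) - 1 \<le> card ((\<Union>k\<in>K. A k) - {a})"
            by (simp add: card_Diff_singleton_if)
          ultimately show ?thesis by simp
        qed simp
      qed (use finI finA in auto)
      then obtain h where h: "inj_on h (I - {i})" "\<And>k. k \<in> I - {i} \<Longrightarrow> h k \<in> A k - {a}" by auto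
      have "inj_on (h(i := a)) I"
      proof (rule inj_onI)
        fix x y assume xy: "x \<in> I" "y \<in> I" "(h(i := a)) x = (h(i := a)) y"
        then show "x = y" using h(2)[of x] h(2)[of y] inj_onD[OF h(1), of x y]
          by (auto split: if_splits)
      qed
      moreover have "\<forall>k\<in>I. (h(i := a)) k \<in> A k" using h a by auto
      ultimately show ?thesis by blast
    qed simp
  qed
qed

section \<open>Matchings into copies\<close>

lemma finite_copies: "finite W \<Longrightarrow> finite (copies \<kappa> W)"
  by (simp add: copies_def)

text \<open>
  Every edge of such a matching has exactly one end in \<open>L\<close>, so \<open>card M = card L\<close> says that \<open>M\<close> saturates
  \<open>L\<close>.
\<close>

lemma aux_matching_iff_injection:
  assumes "finite L" "L \<subseteq> R" "W \<subseteq> Y"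
  shows "(\<exists>M. matching_from_to (aux_edges E \<kappa> R Y) (Inl ` L) (Inr ` copies \<kappa> W) M \<and>
            card M = card L) \<longleftrightarrow>
         (\<exists>f. inj_on f L \<and> (\<forall>l\<in>L. f l \<in> copies \<kappa> W \<and> {fst (f l), l} \<in> E))"
    (is "?l \<longleftrightarrow> ?r")
proof
  assume ?l
  then obtain M where ME: "M \<subseteq> aux_edges E \<kappa> R Y"
    and disj: "\<And>e f. e \<in> M \<Longrightarrow> f \<in> M \<Longrightarrow> e \<noteq> f \<Longrightarrow> e \<inter> f = {}"
    and ft: "\<And>e. e \<in> M \<Longrightarrow> \<exists>s\<in>Inl ` L. \<exists>t\<in>Inr ` copies \<kappa> W. e = {s, t}"
    and card: "card M = card L"
    unfolding matching_from_to_def matching_def by metis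
  have "\<forall>e\<in>M. \<exists>l\<in>L. \<exists>t\<in>copies \<kappa> W. e = {Inl l, Inr t}" using ft by fast
  then obtain s where s: "\<And>e. e \<in> M \<Longrightarrow> s e \<in> L \<and> (\<exists>t\<in>copies \<kappa> W. e = {Inl (s e), Inr t})"
    by metis
  have "inj_on s M"
  proof (rule inj_onI)
    fix e f assume ef: "e \<in> M" "f \<in> M" "s e = s f"
    have "Inl (s e) \<in> e" if "e \<in> M" for e using s[OF that] by (metis insertI1)
    then have "Inl (s e) \<in> e \<inter> f" using ef by (metis IntI)
    then show "e = f" using disj ef by blast
  qed
  then have "card (s ` M) = card L" using card by (simp add: card_image)
  moreover have "s ` M \<subseteq> L" using s by blast
  ultimately have "s ` M = L" using assms(1) by (intro card_subset_eq)
  then have "\<forall>l\<in>L. \<exists>t\<in>copies \<kappa> W. {Inl l, Inr t} \<in> M" using s by (metis imageE)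
  then obtain f where f: "\<And>l. l \<in> L \<Longrightarrow> f l \<in> copies \<kappa> W \<and> {Inl l, Inr (f l)} \<in> M" by metis
  have "inj_on f L"
  proof (rule inj_onI)
    fix k l assume kl: "k \<in> L" "l \<in> L" "f k = f l"
    then have "{Inl k, Inr (f k)} = {Inl l, Inr (f l)}"
      using f[OF kl(1)] f[OF kl(2)] disj by blast
    then show "k = l" by (auto simp: doubleton_eq_iff)
  qed
  moreover have "{fst (f l), l} \<in> E" if l: "l \<in> L" for l
  proof -
    have "{Inl l, Inr (f l)} \<in> aux_edges E \<kappa> R Y" using f[OF l] ME by auto
    then show ?thesis by (auto simp: aux_edges_def doubleton_eq_iff)
  qed
  ultimately show ?r using f by blast
next
  assume ?r
  then obtain f where f: "inj_on f L" "\<And>l. l \<in> L \<Longrightarrow> f l \<in> copies \<kappa> W"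
    "\<And>l. l \<in> L \<Longrightarrow> {fst (f l), l} \<in> E" by auto
  define M where "M = (\<lambda>l. {Inl l, Inr (f l)}) ` L"
  have "card M = card L" unfolding M_def
    by (intro card_image inj_onI) (auto simp: doubleton_eq_iff)
  moreover have "M \<subseteq> aux_edges E \<kappa> R Y"
  proof
    fix e assume "e \<in> M"
    then obtain l where l: "l \<in> L" "e = {Inl l, Inr (f l)}" by (auto simp: M_def)
    obtain y i where yi: "f l = (y, i)" by (cases "f l")
    have "(y, i) \<in> copies \<kappa> Y" using f(2)[OF l(1)] yi assms(3) by (auto simp: copies_def)
    moreover have "{y, l} \<in> E" using f(3)[OF l(1)] yi by simp
    ultimately show "e \<in> aux_edges E \<kappa> R Y" using l yi assms(2) by (auto simp: aux_edges_def)
  qed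
  moreover have "e \<inter> e' = {}" if "e \<in> M" "e' \<in> M" "e \<noteq> e'" for e e'
    using that f(1) by (auto simp: M_def inj_on_def)
  moreover have "\<forall>e\<in>M. \<exists>s\<in>Inl ` L. \<exists>t\<in>Inr ` copies \<kappa> W. e = {s, t}"
    unfolding M_def using f(2) by blast
  ultimately show ?l
    unfolding matching_from_to_def matching_def by (intro exI[of _ M] conjI) simp_all
qed

lemma injection_into_copies_iff:
  assumes "finite L"
  shows "(\<exists>f. inj_on f L \<and> (\<forall>l\<in>L. f l \<in> copies \<kappa> W \<and> {fst (f l), l} \<in> E)) \<longleftrightarrow>
         (\<exists>g. (\<forall>l\<in>L. g l \<in> W \<and> {g l, l} \<in> E) \<and> (\<forall>w\<in>W. card {l \<in> L. g l = w} \<le> \<kappa> w))"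
    (is "?l \<longleftrightarrow> ?r")
proof
  assume ?l
  then obtain f where f: "inj_on f L" "\<And>l. l \<in> L \<Longrightarrow> f l \<in> copies \<kappa> W"
    "\<And>l. l \<in> L \<Longrightarrow> {fst (f l), l} \<in> E" by auto
  have "card {l \<in> L. fst (f l) = w} \<le> card {..<\<kappa> w}" for w
  proof (rule card_inj_on_le)
    show "inj_on (snd \<circ> f) {l \<in> L. fst (f l) = w}"
      using f(1) by (auto simp: inj_on_def prod_eq_iff)
    show "(snd \<circ> f) ` {l \<in> L. fst (f l) = w} \<subseteq> {..<\<kappa> w}"
      using f(2) by (fastforce simp: copies_def)
  qed simp
  moreover have "fst (f l) \<in> W" if "l \<in> L" for l using f(2)[OF that] by (auto simp: copies_def)
  ultimately show ?r using f(3) by (intro exI[of _ "fst \<circ> f"]) auto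
next
  assume ?r
  then obtain g where g: "\<And>l. l \<in> L \<Longrightarrow> g l \<in> W \<and> {g l, l} \<in> E"
    "\<And>w. w \<in> W \<Longrightarrow> card {l \<in> L. g l = w} \<le> \<kappa> w" by auto
  have "\<exists>h. inj_on h {l \<in> L. g l = w} \<and> h ` {l \<in> L. g l = w} \<subseteq> {..<\<kappa> w}" if "w \<in> W" for w
    using card_le_inj[of "{l \<in> L. g l = w}" "{..<\<kappa> w}"] assms g(2)[OF that] by auto
  then obtain h where h: "\<And>w. w \<in> W \<Longrightarrow>
      inj_on (h w) {l \<in> L. g l = w} \<and> h w ` {l \<in> L. g l = w} \<subseteq> {..<\<kappa> w}" by metis
  have "inj_on (\<lambda>l. (g l, h (g l) l)) L"
  proof (rule inj_onI)
    fix k l assume kl: "k \<in> L" "l \<in> L" "(g k, h (g k) k) = (g l, h (g l) l)"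
    then show "k = l" using h[of "g l"] g(1)[OF kl(2)] by (auto simp: inj_on_def)
  qed
  moreover have "(g l, h (g l) l) \<in> copies \<kappa> W" if "l \<in> L" for l
    using h[of "g l"] g(1)[OF that] that by (auto simp: copies_def)
  ultimately show ?l using g(1) by (intro exI[of _ "\<lambda>l. (g l, h (g l) l)"]) auto
qed

text \<open>
  A vertex of \<open>L(W)\<close> cannot exhaust its capacity outside \<open>W\<close>; this is the form in which \<open>L(W)\<close> enters
  the theory of D-sets.
\<close>

lemma mem_Lset_iff:
  assumes "fin_sgraph V E"
  shows "v \<in> Lset E \<kappa> R W \<longleftrightarrow> v \<in> R \<and> card (nbhd E v - W) < \<kappa> v"
proof -
  have "card (nbhd E v) = card (nbhd E v \<inter> W) + card (nbhd E v - W)"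
    using finite_nbhd[OF assms] by (metis card_Int_Diff)
  then show ?thesis by (auto simp: Lset_def deg_def)
qed

text \<open>
  Let \<open>J \<subseteq> L(W)\<close> violate Hall's condition, let \<open>N\<close> be its neighbours in \<open>W\<close> and \<open>U = W - N\<close>. A vertex of
  \<open>J\<close> has no neighbour in \<open>U\<close> and so is not in \<open>L(U)\<close>. Hence \<open>L(U)\<close> has lost at least \<open>card J\<close>
  vertices, more than the number of copies lost, and the inequality passes to \<open>U\<close>. The descent is
  strict because every vertex of \<open>L(W)\<close> has a neighbour in \<open>W\<close>, and it cannot reach the empty set
  because \<open>N\<close> has fewer copies than \<open>L(W)\<close> has vertices.
\<close>

lemma small_Lset_imp_injection:
  assumes g: "fin_sgraph V E" and "finite W" "W \<noteq> {}" and R: "R \<subseteq> V"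
    and cap: "\<And>v. v \<in> R \<Longrightarrow> \<kappa> v \<le> deg E v"
    and pos: "\<And>w. w \<in> W \<Longrightarrow> \<kappa> w > 0"
    and small: "card (Lset E \<kappa> R W) \<le> card (copies \<kappa> W)"
  shows "\<exists>U. U \<noteq> {} \<and> U \<subseteq> W \<and>
    (\<exists>f. inj_on f (Lset E \<kappa> R U) \<and>
         (\<forall>l\<in>Lset E \<kappa> R U. f l \<in> copies \<kappa> U \<and> {fst (f l), l} \<in> E))"
  using assms(2,3) pos small
proof (induction W rule: finite_psubset_induct)
  case (psubset W)
  define L where "L = Lset E \<kappa> R W"
  have "L \<subseteq> V" using R by (auto simp: L_def Lset_def)
  then have finL: "finite L" using g finite_subset by (auto simp: fin_sgraph_def)
  define A where "A = (\<lambda>l. copies \<kappa> (nbhd E l \<inter> W))"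
  have finA: "finite (A l)" for l using psubset.hyps by (simp add: A_def finite_copies)
  show ?case
  proof (cases "\<forall>J. J \<subseteq> L \<longrightarrow> card J \<le> card (\<Union>j\<in>J. A j)")
    case True
    then obtain f where f: "inj_on f L" "\<And>l. l \<in> L \<Longrightarrow> f l \<in> A l"
      using hall[OF finL, of A] finA by auto
    have "f l \<in> copies \<kappa> W \<and> {fst (f l), l} \<in> E" if "l \<in> L" for l
      using f(2)[OF that] by (auto simp: A_def copies_def nbhd_def insert_commute)
    then show ?thesis using f(1) psubset.prems(1) by (intro exI[of _ W]) (auto simp: L_def)
  next
    case False
    then obtain J where J: "J \<subseteq> L" "card (\<Union>j\<in>J. A j) < card J" by auto
    define N where "N = (\<Union>j\<in>J. nbhd E j) \<inter> W"
    define U where "U = W - N"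
    have NW: "N \<subseteq> W" by (auto simp: N_def)
    have "(\<Union>j\<in>J. A j) = copies \<kappa> N" by (auto simp: A_def N_def copies_def)
    then have cN: "card (copies \<kappa> N) < card J" using J(2) by simp
    have "copies \<kappa> W = copies \<kappa> U \<union> copies \<kappa> N" "copies \<kappa> U \<inter> copies \<kappa> N = {}"
      using NW by (auto simp: U_def copies_def)
    moreover have "finite N" "finite U" using NW psubset.hyps finite_subset by (auto simp: U_def)
    ultimately have split: "card (copies \<kappa> W) = card (copies \<kappa> U) + card (copies \<kappa> N)"
      by (simp add: card_Un_disjoint finite_copies)
    have "Lset E \<kappa> R U \<subseteq> L - J"
    proof
      fix v assume v: "v \<in> Lset E \<kappa> R U"
      then have vR: "v \<in> R" "card (nbhd E v - U) < \<kappa> v" using mem_Lset_iff[OF g] by auto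
      have "card (nbhd E v - W) \<le> card (nbhd E v - U)"
        using finite_nbhd[OF g] by (intro card_mono) (auto simp: U_def)
      then have "v \<in> L" using vR mem_Lset_iff[OF g] by (auto simp: L_def)
      moreover have "v \<notin> J"
      proof
        assume "v \<in> J"
        then have "nbhd E v - U = nbhd E v" by (auto simp: U_def N_def)
        then show False using vR cap[OF vR(1)] by (simp add: deg_def)
      qed
      ultimately show "v \<in> L - J" by blast
    qed
    then have "card (Lset E \<kappa> R U) \<le> card (L - J)" using finL by (intro card_mono) auto
    also have "\<dots> = card L - card J" using J(1) finL by (meson card_Diff_subset finite_subset)
    finally have cU: "card (Lset E \<kappa> R U) \<le> card L - card J" .
    have cJ: "card J \<le> card L" using J(1) finL by (rule card_mono[rotated])
    have cL: "card L \<le> card (copies \<kappa> W)" using psubset.prems(3) by (simp add: L_def)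
    have "U \<noteq> {}"
    proof
      assume "U = {}"
      then have "card (copies \<kappa> U) = 0" by (simp add: copies_def)
      then show False using split cN cJ cL by simp
    qed
    moreover have "N \<noteq> {}"
    proof
      assume N0: "N = {}"
      have "J \<noteq> {}" using J(2) by auto
      then obtain j where j: "j \<in> J" by auto
      then have jL: "j \<in> R" "card (nbhd E j - W) < \<kappa> j"
        using J(1) mem_Lset_iff[OF g] by (auto simp: L_def)
      have "nbhd E j - W = nbhd E j" using N0 j by (auto simp: N_def)
      then show False using jL cap[OF jL(1)] by (simp add: deg_def)
    qed
    then have "U \<subset> W" using NW by (auto simp: U_def)
    moreover have "card (Lset E \<kappa> R U) \<le> card (copies \<kappa> U)" using cU cL cJ cN split by linarith
    ultimately have "\<exists>T. T \<noteq> {} \<and> T \<subseteq> U \<and>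
      (\<exists>f. inj_on f (Lset E \<kappa> R T) \<and>
           (\<forall>l\<in>Lset E \<kappa> R T. f l \<in> copies \<kappa> T \<and> {fst (f l), l} \<in> E))"
      using psubset.IH[of U] psubset.prems(2) by blast
    then show ?thesis using \<open>U \<subset> W\<close> by blast
  qed
qed

section \<open>Uniqueness of the D-set\<close>

text \<open>
  Here \<open>A\<close>, the selection of \<open>B\<close>, provides the matching: every vertex of \<open>R - B\<close> is selected by some
  vertex of \<open>B\<close>, which lies in \<open>Y\<close> since \<open>R\<close> is independent, and has positive capacity since it selects.
\<close>

lemma other_D_set_imp_assignment:
  assumes g: "fin_sgraph V E" and cap: "\<And>v. v \<in> V \<Longrightarrow> \<kappa> v \<le> deg E v"
    and parts: "V = R \<union> Y" "R \<inter> Y = {}" and ind: "independent E R"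
    and full: "\<And>y. y \<in> Y \<Longrightarrow> \<exists>x\<in>R. \<kappa> x = deg E x \<and> y \<in> nbhd E x"
    and B: "is_D_set V E \<kappa> B" "B \<noteq> R"
  shows "\<exists>W g. W \<noteq> {} \<and> W \<subseteq> pos_part \<kappa> Y \<and>
    (\<forall>l\<in>Lset E \<kappa> R W. g l \<in> W \<and> {g l, l} \<in> E) \<and>
    (\<forall>w\<in>W. card {l \<in> Lset E \<kappa> R W. g l = w} \<le> \<kappa> w)"
proof -
  obtain A where "selection V E \<kappa> B A" using B(1) is_D_set_iff_selection[OF g] by blast
  then have BV: "B \<subseteq> V" and A: "\<And>x. x \<in> B \<Longrightarrow> A x \<subseteq> nbhd E x - B"
    and c0: "\<And>x. x \<in> B \<Longrightarrow> card (A x) = min (deg E x) (\<kappa> x)"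
    and cov: "V - B \<subseteq> (\<Union>x\<in>B. A x)"
    by (auto simp: selection_def)
  have c: "card (A x) = \<kappa> x" if "x \<in> B" for x
    using c0[OF that] cap[of x] BV that by (simp add: min_absorb2 subset_iff)
  have finAx: "finite (A x)" if "x \<in> B" for x
    using A[OF that] finite_nbhd[OF g] finite_subset by blast
  define W where "W = pos_part \<kappa> (B \<inter> Y)"
  have coverer: "\<exists>w\<in>W. r \<in> A w" if r: "r \<in> R - B" for r
  proof -
    obtain x where x: "x \<in> B" "r \<in> A x" using r cov parts by blast
    then have "{x, r} \<in> E" using A by (auto simp: nbhd_def)
    then have "x \<notin> R" using ind r by (auto simp: independent_def)
    then have "x \<in> Y" using x BV parts by auto
    moreover have "\<kappa> x > 0" using c[OF x(1)] x finAx card_gt_0_iff by fastforce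
    ultimately show ?thesis using x by (auto simp: W_def pos_part_def)
  qed
  (* If W were empty, B would contain R and some y in Y; but a tight neighbour x of y in R takes all
     its neighbours, and they lie outside B. *)
  have "W \<noteq> {}"
  proof
    assume "W = {}"
    then have RB: "R \<subseteq> B" using coverer by blast
    then obtain y where y: "y \<in> B" "y \<in> Y" using B(2) BV parts by blast
    then obtain x where x: "x \<in> R" "\<kappa> x = deg E x" "y \<in> nbhd E x" using full by blast
    then have "x \<in> B" using RB by auto
    then have "A x = nbhd E x"
      using A c x(2) finite_nbhd[OF g] by (intro card_subset_eq) (auto simp: deg_def)
    then show False using A[OF \<open>x \<in> B\<close>] x(3) y(1) by blast
  qed
  have LB: "Lset E \<kappa> R W \<subseteq> R - B"
  proof
    fix v assume "v \<in> Lset E \<kappa> R W"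
    then have v: "v \<in> R" "card (nbhd E v - W) < \<kappa> v" using mem_Lset_iff[OF g] by auto
    have "v \<notin> B"
    proof
      assume vB: "v \<in> B"
      have "A v \<subseteq> nbhd E v - W" using A[OF vB] by (auto simp: W_def pos_part_def)
      then have "card (A v) \<le> card (nbhd E v - W)" using finite_nbhd[OF g] by (intro card_mono) auto
      then show False using c[OF vB] v(2) by simp
    qed
    then show "v \<in> R - B" using v by auto
  qed
  then obtain h where h: "\<And>l. l \<in> Lset E \<kappa> R W \<Longrightarrow> h l \<in> W \<and> l \<in> A (h l)"
    using coverer by (metis subsetD)
  have WB: "W \<subseteq> B" by (auto simp: W_def pos_part_def)
  have "{h l, l} \<in> E" if l: "l \<in> Lset E \<kappa> R W" for l
    using h[OF l] A WB by (fastforce simp: nbhd_def)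
  moreover have "card {l \<in> Lset E \<kappa> R W. h l = w} \<le> \<kappa> w" if w: "w \<in> W" for w
  proof -
    have "w \<in> B" using w WB by auto
    moreover have "{l \<in> Lset E \<kappa> R W. h l = w} \<subseteq> A w" using h by auto
    ultimately show ?thesis using c finAx card_mono by metis
  qed
  moreover have "W \<subseteq> pos_part \<kappa> Y" by (auto simp: W_def pos_part_def)
  ultimately show ?thesis using h \<open>W \<noteq> {}\<close> by (intro exI[of _ W] exI[of _ h]) auto
qed

theorem theorem2:
  fixes V :: "'a set" and E :: "'a set set" and \<kappa> :: "'a \<Rightarrow> nat" and X Y Z :: "'a set"
  assumes graph: "fin_sgraph V E"
    and cap_le_deg: "\<forall>u\<in>V. \<kappa> u \<le> deg E u"
    and edge_cap: "\<forall>u v. {u, v} \<in> E \<longrightarrow> \<kappa> u > 0 \<or> \<kappa> v > 0"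
    and X_eq: "X = {x \<in> V. \<kappa> x = deg E x}"
    and Y_eq: "Y = nbhd_set E X - X"
    and Z_eq: "Z = V - (X \<union> Y)"
  shows "(\<not> independent E (X \<union> Z) \<longrightarrow>
            (\<exists>B1 B2. is_D_set V E \<kappa> B1 \<and> is_D_set V E \<kappa> B2 \<and> B1 \<noteq> B2)) \<and>
         (independent E (X \<union> Z) \<longrightarrow>
            ((\<exists>!B. is_D_set V E \<kappa> B) \<longleftrightarrow>
             (\<forall>W. W \<noteq> {} \<and> W \<subseteq> pos_part \<kappa> Y \<longrightarrow>
                \<not> (\<exists>M. matching_from_to (aux_edges E \<kappa> (X \<union> Z) Y)
                         (Inl ` Lset E \<kappa> (X \<union> Z) W) (Inr ` copies \<kappa> W) M \<and>
                       card M = card (Lset E \<kappa> (X \<union> Z) W)))) \<and>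
            ((\<forall>W. W \<noteq> {} \<and> W \<subseteq> pos_part \<kappa> Y \<longrightarrow>
                \<not> (\<exists>M. matching_from_to (aux_edges E \<kappa> (X \<union> Z) Y)
                         (Inl ` Lset E \<kappa> (X \<union> Z) W) (Inr ` copies \<kappa> W) M \<and>
                       card M = card (Lset E \<kappa> (X \<union> Z) W))) \<longleftrightarrow>
             (\<forall>W. W \<noteq> {} \<and> W \<subseteq> pos_part \<kappa> Y \<longrightarrow>
                card (Lset E \<kappa> (X \<union> Z) W) > card (copies \<kappa> W))))"
proof -
  define R where "R = X \<union> Z"
  have cap: "\<kappa> v \<le> deg E v" if "v \<in> V" for v using cap_le_deg that by auto
  have YV: "Y \<subseteq> V" using Y_eq nbhd_subset[OF graph] by (auto simp: nbhd_set_def)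
  have XV: "X \<subseteq> V" using X_eq by auto
  have parts: "V = R \<union> Y" "R \<inter> Y = {}" using YV XV Y_eq Z_eq by (auto simp: R_def)
  have RV: "R \<subseteq> V" using parts by auto
  have finV: "finite V" using graph by (simp add: fin_sgraph_def)
  have finL: "finite (Lset E \<kappa> R W)" for W
    using finite_subset[OF _ finV] RV by (auto simp: Lset_def)
  have full: "\<exists>x\<in>R. \<kappa> x = deg E x \<and> y \<in> nbhd E x" if "y \<in> Y" for y
    using that Y_eq X_eq by (auto simp: nbhd_set_def R_def)

  have two: "\<exists>B1 B2. is_D_set V E \<kappa> B1 \<and> is_D_set V E \<kappa> B2 \<and> B1 \<noteq> B2"
    if nind: "\<not> independent E R"
  proof -
    (* S is enlarged to a set T of size \<kappa> r. A neighbour of r outside T is slack: a tight one is in X, so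
       r is not in Z but in X, and then T is already the whole neighbourhood. *)
    have pick: "\<exists>B. is_D_set V E \<kappa> B \<and> r \<in> B \<and> S \<inter> B = {}"
      if r: "r \<in> R" and S: "S \<subseteq> nbhd E r" "card S \<le> \<kappa> r" for r S
    proof -
      have rV: "r \<in> V" using r RV by auto
      obtain T where T: "S \<subseteq> T" "T \<subseteq> nbhd E r" "card T = \<kappa> r"
        using exists_subset_between[of S "\<kappa> r" "nbhd E r"] S cap[OF rV] finite_nbhd[OF graph]
        by (auto simp: deg_def)
      have "\<kappa> v < deg E v" if v: "v \<in> nbhd E r - T" for v
      proof (rule ccontr)
        assume "\<not> \<kappa> v < deg E v"
        moreover have "v \<in> V" using v nbhd_subset[OF graph] by auto
        ultimately have "v \<in> X" using cap[of v] by (simp add: X_eq)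
        moreover have "r \<in> nbhd E v" using v nbhd_sym by fast
        ultimately have "r \<in> X" using r parts(2) Y_eq by (auto simp: nbhd_set_def)
        then have "T = nbhd E r"
          using T finite_nbhd[OF graph] by (intro card_subset_eq) (auto simp: X_eq deg_def)
        then show False using v by simp
      qed
      then obtain B where "is_D_set V E \<kappa> B" "r \<in> B" "T \<inter> B = {}"
        using D_set_containing_vertex[where \<kappa> = \<kappa>, OF graph rV T(2,3)] by blast
      then show ?thesis using T(1) by blast
    qed
    obtain u v where uv: "u \<in> R" "v \<in> R" "{u, v} \<in> E" "\<kappa> u > 0"
      using nind edge_cap by (metis independent_def insert_commute)
    then have "{v} \<subseteq> nbhd E u" by (simp add: nbhd_def)
    then obtain B1 where "is_D_set V E \<kappa> B1" "{v} \<inter> B1 = {}" using pick[of u "{v}"] uv by auto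
    moreover obtain B2 where "is_D_set V E \<kappa> B2" "v \<in> B2" using pick[of v "{}"] uv by auto
    ultimately show ?thesis by blast
  qed

  let ?M = "\<lambda>W. \<exists>M. matching_from_to (aux_edges E \<kappa> R Y)
                         (Inl ` Lset E \<kappa> R W) (Inr ` copies \<kappa> W) M \<and>
                       card M = card (Lset E \<kappa> R W)"
  have inj_iff: "?M W \<longleftrightarrow> (\<exists>f. inj_on f (Lset E \<kappa> R W) \<and>
      (\<forall>l\<in>Lset E \<kappa> R W. f l \<in> copies \<kappa> W \<and> {fst (f l), l} \<in> E))" if "W \<subseteq> pos_part \<kappa> Y" for W
    using that by (intro aux_matching_iff_injection finL) (auto simp: Lset_def pos_part_def)
  have assign_iff: "?M W \<longleftrightarrow> (\<exists>g. (\<forall>l\<in>Lset E \<kappa> R W. g l \<in> W \<and> {g l, l} \<in> E) \<and>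
      (\<forall>w\<in>W. card {l \<in> Lset E \<kappa> R W. g l = w} \<le> \<kappa> w))" if "W \<subseteq> pos_part \<kappa> Y" for W
    unfolding inj_iff[OF that] by (rule injection_into_copies_iff[OF finL])
  have finW: "finite W" if "W \<subseteq> pos_part \<kappa> Y" for W
    using that finite_subset[OF _ finV] YV by (auto simp: pos_part_def)

  have unique_iff: "(\<exists>!B. is_D_set V E \<kappa> B) \<longleftrightarrow>
      (\<forall>W. W \<noteq> {} \<and> W \<subseteq> pos_part \<kappa> Y \<longrightarrow> \<not> ?M W)" if ind: "independent E R"
  proof -
    have nR: "nbhd E r \<subseteq> Y" if "r \<in> R" for r
      using that ind nbhd_subset[OF graph, of r] parts by (auto simp: independent_def nbhd_def)
    have "\<exists>S. S \<subseteq> nbhd E r \<and> card S = \<kappa> r" if "r \<in> R" for r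
      using that cap[of r] RV obtain_subset_with_card_n[of "\<kappa> r" "nbhd E r"]
      by (metis deg_def subsetD)
    then obtain S where S: "\<And>r. r \<in> R \<Longrightarrow> S r \<subseteq> nbhd E r \<and> card (S r) = \<kappa> r" by metis
    have "selection V E \<kappa> R S"
      unfolding selection_def
    proof (intro conjI ballI subsetI)
      show "y \<in> nbhd E r - R" if "r \<in> R" "y \<in> S r" for r y
        using S[OF that(1)] nR[OF that(1)] that(2) parts(2) by blast
      show "card (S r) = min (deg E r) (\<kappa> r)" if "r \<in> R" for r
        using S[OF that] cap[of r] RV that by (simp add: min_absorb2 subset_iff)
      show "y \<in> (\<Union>r\<in>R. S r)" if y: "y \<in> V - R" for y
      proof -
        obtain x where x: "x \<in> R" "\<kappa> x = deg E x" "y \<in> nbhd E x" using full y parts by blast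
        then have "S x = nbhd E x"
          using S[OF x(1)] finite_nbhd[OF graph] by (intro card_subset_eq) (auto simp: deg_def)
        then show ?thesis using x by auto
      qed
    qed (use RV in auto)
    then have DR: "is_D_set V E \<kappa> R" using is_D_set_iff_selection[OF graph] by blast
    show ?thesis
    proof
      assume un: "\<exists>!B. is_D_set V E \<kappa> B"
      show "\<forall>W. W \<noteq> {} \<and> W \<subseteq> pos_part \<kappa> Y \<longrightarrow> \<not> ?M W"
      proof (intro allI impI notI)
        fix W assume W: "W \<noteq> {} \<and> W \<subseteq> pos_part \<kappa> Y" and m: "?M W"
        from m W have "\<exists>g. (\<forall>l\<in>Lset E \<kappa> R W. g l \<in> W \<and> {g l, l} \<in> E) \<and>
            (\<forall>w\<in>W. card {l \<in> Lset E \<kappa> R W. g l = w} \<le> \<kappa> w)"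
          by (subst (asm) assign_iff) auto
        then obtain g where gm: "\<And>l. l \<in> Lset E \<kappa> R W \<Longrightarrow> g l \<in> W \<and> {g l, l} \<in> E"
          "\<And>w. w \<in> W \<Longrightarrow> card {l \<in> Lset E \<kappa> R W. g l = w} \<le> \<kappa> w"
          by auto
        have "\<exists>B. is_D_set V E \<kappa> B \<and> B \<inter> Y \<noteq> {}"
        proof (rule exists_D_set_meeting[OF graph cap, where W = W and L = "Lset E \<kappa> R W" and g = g])
          show "\<kappa> v \<le> card (nbhd E v - W)" if "v \<in> V - Y - Lset E \<kappa> R W" for v
            using that parts mem_Lset_iff[OF graph, of v \<kappa> R W] by auto
          show "Lset E \<kappa> R W \<subseteq> V - Y" using parts by (auto simp: Lset_def)
        qed (use W YV gm in \<open>auto simp: pos_part_def\<close>)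
        then show False using un DR parts(2) by blast
      qed
    next
      assume b: "\<forall>W. W \<noteq> {} \<and> W \<subseteq> pos_part \<kappa> Y \<longrightarrow> \<not> ?M W"
      have "B = R" if B: "is_D_set V E \<kappa> B" for B
      proof (rule ccontr)
        assume "B \<noteq> R"
        from other_D_set_imp_assignment[OF graph cap parts ind full B this]
        obtain W g where W: "W \<noteq> {}" "W \<subseteq> pos_part \<kappa> Y"
          and gm: "\<forall>l\<in>Lset E \<kappa> R W. g l \<in> W \<and> {g l, l} \<in> E"
            "\<forall>w\<in>W. card {l \<in> Lset E \<kappa> R W. g l = w} \<le> \<kappa> w" by auto
        have "?M W" unfolding assign_iff[OF W(2)] using gm by blast
        then show False using b W by blast
      qed
      then show "\<exists>!B. is_D_set V E \<kappa> B" using DR by blast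
    qed
  qed

  have hall_iff: "(\<forall>W. W \<noteq> {} \<and> W \<subseteq> pos_part \<kappa> Y \<longrightarrow> \<not> ?M W) \<longleftrightarrow>
      (\<forall>W. W \<noteq> {} \<and> W \<subseteq> pos_part \<kappa> Y \<longrightarrow> card (Lset E \<kappa> R W) > card (copies \<kappa> W))"
  proof
    assume b: "\<forall>W. W \<noteq> {} \<and> W \<subseteq> pos_part \<kappa> Y \<longrightarrow> \<not> ?M W"
    show "\<forall>W. W \<noteq> {} \<and> W \<subseteq> pos_part \<kappa> Y \<longrightarrow> card (Lset E \<kappa> R W) > card (copies \<kappa> W)"
    proof (intro allI impI, rule ccontr)
      fix W assume W: "W \<noteq> {} \<and> W \<subseteq> pos_part \<kappa> Y"
        and "\<not> card (Lset E \<kappa> R W) > card (copies \<kappa> W)"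
      then have small: "card (Lset E \<kappa> R W) \<le> card (copies \<kappa> W)" by simp
      obtain U where U: "U \<noteq> {}" "U \<subseteq> W" and f: "\<exists>f. inj_on f (Lset E \<kappa> R U) \<and>
             (\<forall>l\<in>Lset E \<kappa> R U. f l \<in> copies \<kappa> U \<and> {fst (f l), l} \<in> E)"
      proof -
        have "\<kappa> v \<le> deg E v" if "v \<in> R" for v using cap RV that by auto
        moreover have "\<kappa> w > 0" if "w \<in> W" for w using W that by (auto simp: pos_part_def)
        ultimately show ?thesis
          using that small_Lset_imp_injection[of V E W R \<kappa>] graph finW[of W] W RV small by blast
      qed
      have UY: "U \<subseteq> pos_part \<kappa> Y" using U W by auto
      have "?M U" unfolding inj_iff[OF UY] using f .
      then show False using b U UY by blast
    qed
  next
    assume c: "\<forall>W. W \<noteq> {} \<and> W \<subseteq> pos_part \<kappa> Y \<longrightarrow> card (Lset E \<kappa> R W) > card (copies \<kappa> W)"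
    show "\<forall>W. W \<noteq> {} \<and> W \<subseteq> pos_part \<kappa> Y \<longrightarrow> \<not> ?M W"
    proof (intro allI impI notI)
      fix W assume W: "W \<noteq> {} \<and> W \<subseteq> pos_part \<kappa> Y" and m: "?M W"
      then have "\<exists>f. inj_on f (Lset E \<kappa> R W) \<and>
          (\<forall>l\<in>Lset E \<kappa> R W. f l \<in> copies \<kappa> W \<and> {fst (f l), l} \<in> E)"
        by (subst (asm) inj_iff) auto
      then obtain f where "inj_on f (Lset E \<kappa> R W)" "f ` Lset E \<kappa> R W \<subseteq> copies \<kappa> W"
        by blast
      then have "card (Lset E \<kappa> R W) \<le> card (copies \<kappa> W)"
        using finite_copies[OF finW] W by (intro card_inj_on_le) auto
      then show False using c[rule_format, OF W] by simp
    qed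
  qed
  show ?thesis
    using two unique_iff hall_iff unfolding R_def by (intro conjI impI)
qed

end
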